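(* Let $\lambda\in(-\pi/2,\pi/2)$, and put $A_n=|1+ne^{-i\lambda}|+|1-ne^{-i\lambda}|$ for $n\ge 1$ and $B=|1+e^{-i\lambda}|-|1-e^{-i\lambda}|$. Let $f=h+\overline{g}\in\mathcal{H}'$ with $h(z)=z-\sum_{n=2}^\infty |a_n|z^n$ and $g(z)=\sum_{n=1}^\infty |b_n|z^n$. If $$\sum_{n=2}^\infty\frac{A_n}{B}|a_n|+\sum_{n=1}^\infty\frac{A_n}{B}|b_n|\leq 1,$$ then $f\in\mathcal{SP}_{H'}(\lambda)$. Conversely, every $f\in\mathcal{SP}_{H'}(\lambda)$, written as $f=h+\overline{g}$ with $h(z)=z-\sum_{n=2}^\infty |a_n|z^n$ and $g(z)=\sum_{n=1}^\infty |b_n|z^n$, satisfies the coefficient inequality $$\sum_{n=2}^\infty\frac{B}{A_n}|a_n|+\sum_{n=1}^\infty\frac{B}{A_n}|b_n|\leq 1.$$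
   Context: $\mathbb{D}=\{z\in\mathbb{C}:|z|<1\}$ and $\mathbb{D}_r=\{z:|z|<r\}$. $\mathcal{H}'$ is the class of harmonic functions $f=h+\overline{g}$ in $\mathbb{D}$, with $h,g$ analytic in $\mathbb{D}$ of the form $h(z)=z-\sum_{n=2}^\infty |a_n|z^n$, $g(z)=\sum_{n=1}^\infty |b_n|z^n$, that are sense-preserving, i.e. the Jacobian $J_f=|h'|^2-|g'|^2$ is positive on $\mathbb{D}$. For $\lambda\in(-\pi/2,\pi/2)$, a domain $\Omega$ containing the origin is $\lambda$-spirallike if for each $w_0\in\Omega$ the arc of $\lambda$-spiral from the origin to $w_0$, namely $\{w_0\exp(-e^{i\lambda}t):t\ge 0\}\cup\{0\}$, lies in $\Omega$. A sense-preserving harmonic $f$ is hereditarily $\lambda$-spirallike if $f$ is univalent (injective) on $\mathbb{D}$ and $f(\mathbb{D}_r)$ is a $\lambda$-spirallike domain for each $0<r<1$. $\mathcal{SP}_{H'}(\lambda)$ is the class of hereditarily $\lambda$-spirallike functions in $\mathcal{H}'$. *)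

theory Defs
  imports "HOL-Complex_Analysis.Complex_Analysis"
begin

text \<open>
  Functions on the open unit disk are total functions \<open>complex \<Rightarrow> complex\<close> of which only the
  values on \<open>ball 0 1\<close> matter. As the disk is simply connected, its complex-valued harmonic
  functions are those of the form \<open>h + cnj g\<close> with \<open>h\<close> and \<open>g\<close> holomorphic.
\<close>

definition harmonic_decomp ::
    "(complex \<Rightarrow> complex) \<Rightarrow> (complex \<Rightarrow> complex) \<Rightarrow> (complex \<Rightarrow> complex) \<Rightarrow> bool" where
  "harmonic_decomp f h g \<longleftrightarrow>
     h holomorphic_on ball 0 1 \<and> g holomorphic_on ball 0 1 \<and>
     (\<forall>z\<in>ball 0 1. f z = h z + cnj (g z))"

definition jacobian :: "(complex \<Rightarrow> complex) \<Rightarrow> (complex \<Rightarrow> complex) \<Rightarrow> complex \<Rightarrow> real" where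
  "jacobian h g z = (cmod (deriv h z))\<^sup>2 - (cmod (deriv g z))\<^sup>2"

definition sense_preserving_harmonic :: "(complex \<Rightarrow> complex) \<Rightarrow> bool" where
  "sense_preserving_harmonic f \<longleftrightarrow>
     (\<exists>h g. harmonic_decomp f h g \<and> (\<forall>z\<in>ball 0 1. jacobian h g z > 0))"

text \<open>
  The series for \<open>h\<close> starts at index 2 and that for \<open>g\<close> at index 1; the values
  \<open>a 0\<close>, \<open>a 1\<close>, \<open>b 0\<close> are irrelevant.
\<close>

definition signed_coeff_decomp ::
    "(complex \<Rightarrow> complex) \<Rightarrow> (complex \<Rightarrow> complex) \<Rightarrow> (complex \<Rightarrow> complex) \<Rightarrow>
     (nat \<Rightarrow> complex) \<Rightarrow> (nat \<Rightarrow> complex) \<Rightarrow> bool" where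
  "signed_coeff_decomp f h g a b \<longleftrightarrow>
     harmonic_decomp f h g \<and>
     (\<forall>z\<in>ball 0 1. summable (\<lambda>n. of_real (cmod (a (n + 2))) * z ^ (n + 2)) \<and>
        h z = z - (\<Sum>n. of_real (cmod (a (n + 2))) * z ^ (n + 2))) \<and>
     (\<forall>z\<in>ball 0 1. summable (\<lambda>n. of_real (cmod (b (n + 1))) * z ^ (n + 1)) \<and>
        g z = (\<Sum>n. of_real (cmod (b (n + 1))) * z ^ (n + 1)))"

definition H_prime :: "(complex \<Rightarrow> complex) set" where
  "H_prime = {f. \<exists>h g a b. signed_coeff_decomp f h g a b \<and>
                           (\<forall>z\<in>ball 0 1. jacobian h g z > 0)}"

definition spiral_arc :: "real \<Rightarrow> complex \<Rightarrow> complex set" where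
  "spiral_arc lam w0 = {w0 * exp (- (cis lam * of_real t)) | t :: real. t \<ge> 0} \<union> {0}"

definition spirallike_domain :: "real \<Rightarrow> complex set \<Rightarrow> bool" where
  "spirallike_domain lam \<Omega> \<longleftrightarrow>
     open \<Omega> \<and> connected \<Omega> \<and> 0 \<in> \<Omega> \<and> (\<forall>w0\<in>\<Omega>. spiral_arc lam w0 \<subseteq> \<Omega>)"

definition hereditarily_spirallike :: "real \<Rightarrow> (complex \<Rightarrow> complex) \<Rightarrow> bool" where
  "hereditarily_spirallike lam f \<longleftrightarrow>
     sense_preserving_harmonic f \<and> inj_on f (ball 0 1) \<and>
     (\<forall>r. 0 < r \<and> r < 1 \<longrightarrow> spirallike_domain lam (f ` ball 0 r))"

definition SP_H_prime :: "real \<Rightarrow> (complex \<Rightarrow> complex) set" where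
  "SP_H_prime lam = {f \<in> H_prime. hereditarily_spirallike lam f}"

definition spiral_A :: "real \<Rightarrow> nat \<Rightarrow> real" where
  "spiral_A lam n = cmod (1 + of_nat n * cis (- lam)) + cmod (1 - of_nat n * cis (- lam))"

definition spiral_B :: "real \<Rightarrow> real" where
  "spiral_B lam = cmod (1 + cis (- lam)) - cmod (1 - cis (- lam))"

end

theory Submission
  imports Defs
begin

text \<open>
  On the positive real axis \<open>h'\<close> and \<open>g'\<close> are real, so the Jacobian condition alone gives
  \<open>(\<Sum>n. n * \<bar>a n\<bar> * r ^ (n - 1)) + (\<Sum>n. n * \<bar>b n\<bar> * r ^ (n - 1)) < 1\<close> for \<open>0 \<le> r < 1\<close>. This makes
  \<open>f\<close> minus the identity a strict contraction on every smaller disk, so \<open>f\<close> is injective; and letting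
  \<open>r\<close> tend to 1 bounds \<open>\<Sum>n. n * (\<bar>a n\<bar> + \<bar>b n\<bar>)\<close> by 1, which implies the necessary condition as
  \<open>B / A n \<le> 1\<close>.

  For sufficiency, put \<open>D f z = z * h' z - cnj (z * g' z)\<close>. The coefficient inequality yields
  \<open>\<bar>cis (- lam) * D f - f\<bar> \<le> \<bar>cis (- lam) * D f + f\<bar>\<close>, that is \<open>Re (cnj (D f) * cis lam * f) \<ge> 0\<close>. Pulling
  the spiral \<open>w t = f z0 * exp (- cis lam * t)\<close> back by \<open>f\<close>, this is the statement that the squared modulus of
  \<open>inv f (w t)\<close> has nonpositive derivative, so the spiral never leaves the image of a disk around 0
  containing \<open>z0\<close>.
\<close>

section \<open>Real derivative and Jacobian of a harmonic mapping\<close>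

lemma harmonic_decomp_has_derivative:
  assumes "harmonic_decomp f h g" and "z \<in> ball 0 1"
  shows "(f has_derivative (\<lambda>v. deriv h z * v + cnj (deriv g z * v))) (at z)"
proof -
  have "(h has_field_derivative deriv h z) (at z)" "(g has_field_derivative deriv g z) (at z)"
    using assms by (auto simp: harmonic_decomp_def intro: holomorphic_derivI)
  then have "((\<lambda>z. h z + cnj (g z)) has_derivative (\<lambda>v. deriv h z * v + cnj (deriv g z * v))) (at z)"
    by (intro has_derivative_add has_derivative_cnj) (auto simp: has_field_derivative_def)
  then show ?thesis
    by (rule has_derivative_transform_within_open[of _ _ _ _ "ball 0 1"])
       (use assms in \<open>auto simp: harmonic_decomp_def\<close>)
qed

text \<open>A constant may be moved between \<open>h\<close> and \<open>g\<close>, so decompositions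
  are not unique, and membership in \<open>H_prime\<close> provides a positive Jacobian only for
  some decomposition. The real derivative of \<open>f\<close> determines both complex derivatives,
  so positivity carries over to a given decomposition.\<close>

lemma jacobian_decomp_unique:
  assumes "harmonic_decomp f h g" and "harmonic_decomp f h' g'" and "z \<in> ball 0 1"
  shows "jacobian h g z = jacobian h' g' z"
proof -
  have eq: "(\<lambda>v. deriv h z * v + cnj (deriv g z * v)) = (\<lambda>v. deriv h' z * v + cnj (deriv g' z * v))"
    using assms harmonic_decomp_has_derivative has_derivative_unique by blast
  \<comment> \<open>With p and q the derivatives of \<open>h\<close> and \<open>g\<close> at
    \<open>z\<close>, the values at 1 and \<open>\<i>\<close> are p + cnj q and \<open>\<i>\<close>
    times (p - cnj q); together they determine p and q.\<close>
  from fun_cong[OF eq, of 1] fun_cong[OF eq, of \<i>]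
  have "deriv h z = deriv h' z" "deriv g z = deriv g' z"
    by (auto simp: complex_eq_iff)
  then show ?thesis by (simp add: jacobian_def)
qed

text \<open>The real-linear map taking \<open>v\<close> to \<open>p * v + cnj (q * v)\<close> has
  determinant \<open>J\<close>. The quotient is its explicit inverse at \<open>u\<close>, needed for
  the derivative of the inverse function of \<open>f\<close>.\<close>

lemma real_linear_inverse:
  fixes p q u :: complex
  assumes "J = (cmod p)\<^sup>2 - (cmod q)\<^sup>2" and "J \<noteq> 0"
  shows "p * ((cnj p * u - cnj q * cnj u) / of_real J)
       + cnj (q * ((cnj p * u - cnj q * cnj u) / of_real J)) = u"
proof -
  have J: "complex_of_real J = p * cnj p - q * cnj q"
    by (simp add: assms(1) complex_mult_cnj cmod_power2)
  have "p * (cnj p * u - cnj q * cnj u) + cnj (q * (cnj p * u - cnj q * cnj u)) = of_real J * u"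
    unfolding J by (simp add: algebra_simps)
  then show ?thesis
    using assms(2) by (simp add: add_divide_distrib[symmetric])
qed

section \<open>Pulling spirals back to the disk\<close>

text \<open>While the spiral is inside the image, its preimage path has nonincreasing modulus and is
  confined to the compact disk of radius \<open>cmod z0\<close>; this in turn keeps the spiral
  inside the image for all time. The bound on \<open>cmod z\<close> is what makes the images of all
  smaller disks spirallike.\<close>

lemma spiral_flow_contracts:
  assumes decomp: "harmonic_decomp f h g"
    and jac: "\<And>z. z \<in> ball 0 1 \<Longrightarrow> jacobian h g z > 0"
    and inj: "inj_on f (ball 0 1)"
    and pos: "\<And>z. z \<in> ball 0 1 \<Longrightarrow>
                Re (cnj (z * deriv h z - cnj (z * deriv g z)) * (cis lam * f z)) \<ge> 0"
    and z0: "z0 \<in> ball 0 1" and t: "t \<ge> 0"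
  shows "\<exists>z. cmod z \<le> cmod z0 \<and> f z = f z0 * exp (- (cis lam * of_real t))"
proof -
  let ?D = "ball 0 1 :: complex set"
  define w where "w s = f z0 * exp (- (cis lam * of_real s))" for s :: real
  define \<phi> where "\<phi> = inv_into ?D f"
  have \<phi>_f: "\<phi> (f z) = z" if "z \<in> ?D" for z
    using inj that by (simp add: \<phi>_def)
  have f_\<phi>: "f (\<phi> v) = v" "\<phi> v \<in> ?D" if "v \<in> f ` ?D" for v
    using that unfolding \<phi>_def by (rule f_inv_into_f, rule inv_into_into)
  have f_deriv: "(f has_derivative (\<lambda>v. deriv h z * v + cnj (deriv g z * v))) (at z)"
    if "z \<in> ?D" for z
    using decomp that by (rule harmonic_decomp_has_derivative)
  have contf: "continuous_on ?D f"
    using f_deriv has_derivative_continuous by (intro continuous_at_imp_continuous_on) blast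
  have "open (f ` ?D)"
    using contf inj by (intro invariance_of_domain) auto
  have w_deriv: "(w has_derivative (\<lambda>r. of_real r * (- cis lam * w s))) (at s)" for s
  proof -
    have "((\<lambda>u. f z0 * exp (- (cis lam * u))) has_field_derivative - cis lam * w s) (at (of_real s))"
      unfolding w_def by (auto intro!: derivative_eq_intros)
    then have "(w has_vector_derivative - cis lam * w s) (at s)"
      unfolding w_def by (rule has_vector_derivative_real_field)
    then show ?thesis
      by (simp add: has_vector_derivative_def scaleR_conv_of_real)
  qed
  have contw: "continuous_on S w" for S
    unfolding w_def by (intro continuous_intros)

  have norm_deriv: "\<exists>y. ((\<lambda>s. \<phi> (w s) \<bullet> \<phi> (w s)) has_real_derivative y) (at s) \<and> y \<le> 0"
    if "w s \<in> f ` ?D" for s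
  proof -
    define z where "z = \<phi> (w s)"
    have z: "z \<in> ?D" "f z = w s"
      using f_\<phi> that by (auto simp: z_def)
    define p where "p = deriv h z"
    define q where "q = deriv g z"
    define J where "J = jacobian h g z"
    have J: "J = (cmod p)\<^sup>2 - (cmod q)\<^sup>2" "J > 0"
      using jac[OF z(1)] by (auto simp: J_def p_def q_def jacobian_def)
    define G where "G = (\<lambda>u. (cnj p * u - cnj q * cnj u) / of_real J)"
    \<comment> \<open>\<open>G\<close> is a right inverse of the derivative of \<open>f\<close> at
      \<open>z\<close>, so the inverse function theorem makes it the derivative of
      \<open>\<phi>\<close> at \<open>f z\<close>.\<close>
    have "(\<lambda>v. p * v + cnj (q * v)) \<circ> G = id"
      using real_linear_inverse[OF J(1)] J(2) by (auto simp: G_def fun_eq_iff)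
    then have "(\<phi> has_derivative G) (at (f z))"
      unfolding p_def q_def
      by (intro has_derivative_inverse_strong[OF open_ball z(1) contf \<phi>_f f_deriv[OF z(1)]])
    then have "((\<lambda>s. \<phi> (w s)) has_derivative (\<lambda>r. G (of_real r * (- cis lam * w s)))) (at s)"
      using has_derivative_compose[OF w_deriv, of \<phi> G] by (simp add: z)
    then have "((\<lambda>s. \<phi> (w s) \<bullet> \<phi> (w s)) has_derivative
        (\<lambda>r. z \<bullet> G (of_real r * (- cis lam * w s)) + G (of_real r * (- cis lam * w s)) \<bullet> z)) (at s)"
      unfolding z_def by (intro has_derivative_inner)
    \<comment> \<open>\<open>G\<close> is only real-linear, but this suffices to read off a
      derivative in the real time variable.\<close>
    moreover have "G (of_real r * (- cis lam * w s)) = r *\<^sub>R G (- cis lam * w s)" for r :: real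
      by (simp add: G_def scaleR_conv_of_real field_simps)
    ultimately have d: "((\<lambda>s. \<phi> (w s) \<bullet> \<phi> (w s)) has_real_derivative 2 * (z \<bullet> G (- cis lam * w s))) (at s)"
      unfolding has_field_derivative_def
      by (elim has_derivative_eq_rhs) (simp add: inner_commute fun_eq_iff)
    \<comment> \<open>The inner product is \<open>Re (cnj z * G (- cis lam * w s))\<close>;
      conjugating the \<open>q\<close> term under the real part produces the expression bounded by
      \<open>pos\<close>.\<close>
    have "z \<bullet> G (- cis lam * w s)
        = - Re (cnj (z * p - cnj (z * q)) * (cis lam * f z)) / J"
      using J(2) by (simp add: G_def z inner_complex_def field_simps)
    also have "\<dots> \<le> 0"
      using pos[OF z(1)] J(2) unfolding p_def q_def by (intro divide_nonpos_pos) auto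
    finally show ?thesis using d by force
  qed
  have contract: "cmod (\<phi> (w s)) \<le> cmod z0"
    if "s \<ge> 0" "\<And>r. 0 \<le> r \<Longrightarrow> r \<le> s \<Longrightarrow> w r \<in> f ` ?D" for s
  proof -
    have "\<phi> (w s) \<bullet> \<phi> (w s) \<le> \<phi> (w 0) \<bullet> \<phi> (w 0)"
      using that norm_deriv
      by (intro DERIV_nonpos_imp_nonincreasing[of 0 s "\<lambda>s. \<phi> (w s) \<bullet> \<phi> (w s)"]) auto
    moreover have "\<phi> (w 0) = z0"
      using \<phi>_f[OF z0] by (simp add: w_def)
    ultimately show ?thesis by (simp add: norm_le)
  qed
  \<comment> \<open>The first exit time from the image would be a limit of points of the compact
    set \<open>f ` cball 0 (cmod z0)\<close>, hence not an exit time.\<close>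
  have stays: "w s \<in> f ` ?D" if "s \<ge> 0" for s
  proof (rule ccontr)
    assume "w s \<notin> f ` ?D"
    define E where "E = {r. 0 \<le> r \<and> w r \<notin> f ` ?D}"
    have "closed (w -` (- f ` ?D))"
      using \<open>open (f ` ?D)\<close> contw by (intro closed_vimage) (auto simp: closed_open)
    then have "closed E"
      unfolding E_def vimage_def Compl_iff by (intro closed_Collect_conj closed_Collect_le) auto
    have "s \<in> E" "bdd_below E"
      using \<open>w s \<notin> f ` ?D\<close> that by (auto simp: E_def bdd_below_def)
    define T where "T = Inf E"
    have "T \<in> E"
      unfolding T_def using \<open>closed E\<close> \<open>s \<in> E\<close> \<open>bdd_below E\<close> by (intro closed_contains_Inf) auto
    have before: "w r \<in> f ` ?D" if "0 \<le> r" "r < T" for r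
      using that \<open>bdd_below E\<close> cInf_lower[of r E] by (force simp: T_def E_def)
    have "w 0 \<in> f ` ?D"
      using z0 by (simp add: w_def)
    then have "T > 0"
      using \<open>T \<in> E\<close> by (cases "T = 0") (auto simp: E_def)
    have sub: "cball 0 (cmod z0) \<subseteq> ?D"
      using z0 by auto
    have "compact (f ` cball 0 (cmod z0))"
      using continuous_on_subset[OF contf sub] by (intro compact_continuous_image) auto
    moreover have "\<forall>\<^sub>F r in at_left T. w r \<in> f ` cball 0 (cmod z0)"
    proof -
      have "w r \<in> f ` cball 0 (cmod z0)" if "0 < r" "r < T" for r
      proof -
        have "cmod (\<phi> (w r)) \<le> cmod z0"
          using that before by (intro contract) auto
        then show ?thesis
          using f_\<phi>(1)[OF before[of r]] that by (intro image_eqI[of _ _ "\<phi> (w r)"]) auto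
      qed
      then show ?thesis
        using \<open>T > 0\<close> eventually_at_left by blast
    qed
    moreover have "(w \<longlongrightarrow> w T) (at_left T)"
      using has_derivative_continuous[OF w_deriv, of T]
      by (auto simp: isCont_def intro: filterlim_mono at_le)
    ultimately have "w T \<in> f ` cball 0 (cmod z0)"
      using Lim_in_closed_set compact_imp_closed by (metis trivial_limit_at_left_real)
    then show False
      using sub \<open>T \<in> E\<close> by (auto simp: E_def)
  qed
  show ?thesis
    using contract[OF t stays] f_\<phi>(1)[OF stays[OF t]] by (auto simp: w_def)
qed

text \<open>One inequality on the unit disk serves all radii: the flow starting at a point of
  \<open>ball 0 r\<close> never increases the modulus, so it remains in
  \<open>ball 0 r\<close>.\<close>

lemma hereditarily_spirallikeI:
  assumes decomp: "harmonic_decomp f h g"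
    and jac: "\<And>z. z \<in> ball 0 1 \<Longrightarrow> jacobian h g z > 0"
    and inj: "inj_on f (ball 0 1)" and "f 0 = 0"
    and pos: "\<And>z. z \<in> ball 0 1 \<Longrightarrow>
                Re (cnj (z * deriv h z - cnj (z * deriv g z)) * (cis lam * f z)) \<ge> 0"
  shows "hereditarily_spirallike lam f"
  unfolding hereditarily_spirallike_def
proof (intro conjI allI impI)
  show "sense_preserving_harmonic f"
    using decomp jac unfolding sense_preserving_harmonic_def by blast
  show "inj_on f (ball 0 1)" by (rule inj)
  fix r :: real assume r: "0 < r \<and> r < 1"
  then have sub: "ball 0 r \<subseteq> (ball 0 1 :: complex set)" by auto
  have "continuous_on (ball 0 1) f"
    using harmonic_decomp_has_derivative[OF decomp] has_derivative_continuous
    by (intro continuous_at_imp_continuous_on) blast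
  then have cont: "continuous_on (ball 0 r) f"
    using sub by (rule continuous_on_subset)
  show "spirallike_domain lam (f ` ball 0 r)"
    unfolding spirallike_domain_def
  proof (intro conjI ballI)
    show "open (f ` ball 0 r)"
      using cont inj_on_subset[OF inj sub] by (intro invariance_of_domain) auto
    show "connected (f ` ball 0 r)"
      using cont by (intro connected_continuous_image) auto
    show zero: "0 \<in> f ` ball 0 r"
      using r \<open>f 0 = 0\<close> by (intro image_eqI[of _ _ 0]) auto
    fix w0 assume "w0 \<in> f ` ball 0 r"
    then obtain z0 where z0: "z0 \<in> ball 0 r" "w0 = f z0" by auto
    have "w0 * exp (- (cis lam * of_real t)) \<in> f ` ball 0 r" if t: "t \<ge> 0" for t
    proof -
      obtain z where "cmod z \<le> cmod z0" "f z = f z0 * exp (- (cis lam * of_real t))"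
        using spiral_flow_contracts[OF decomp jac inj pos _ t, of z0] z0(1) r by auto
      then show ?thesis
        using z0 by (intro image_eqI[of _ _ z]) auto
    qed
    then show "spiral_arc lam w0 \<subseteq> f ` ball 0 r"
      using zero by (auto simp: spiral_arc_def)
  qed
qed

section \<open>Power series with real coefficients\<close>

text \<open>Both series are indexed from 0, with missing coefficients set to 0, so that
  \<open>h\<close> and \<open>g\<close> are treated alike. Real coefficients suffice because only
  the moduli of \<open>a n\<close> and \<open>b n\<close> occur.\<close>

definition power_series :: "(nat \<Rightarrow> real) \<Rightarrow> complex \<Rightarrow> complex" where
  "power_series c z = (\<Sum>n. of_real (c n) * z ^ n)"

definition converges_in_disk :: "(nat \<Rightarrow> real) \<Rightarrow> bool" where
  "converges_in_disk c \<longleftrightarrow> (\<forall>z::complex. cmod z < 1 \<longrightarrow> summable (\<lambda>n. of_real (c n) * z ^ n))"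

text \<open>The derivative series keeps the index of the original coefficient, so that the two
  series can be combined term by term. At \<open>n = 0\<close> the exponent \<open>n - 1\<close> is
  0, but the factor \<open>of_nat n\<close> kills the term.\<close>

lemma power_series_derivative:
  assumes "converges_in_disk c" and "cmod z < 1"
  shows power_series_has_field_derivative:
      "(power_series c has_field_derivative deriv (power_series c) z) (at z)"
    and power_series_deriv_sums:
      "(\<lambda>n. of_nat n * of_real (c n) * z ^ (n - 1)) sums deriv (power_series c) z"
proof -
  have sm: "summable (\<lambda>n. of_real (c n) * w ^ n)" if "cmod w < 1" for w
    using assms(1) that by (simp add: converges_in_disk_def)
  have d: "(power_series c has_field_derivative (\<Sum>n. diffs (\<lambda>n. complex_of_real (c n)) n * z ^ n)) (at z)"
    unfolding power_series_def using sm assms(2) by (rule termdiffs_strong')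
  then have eq: "deriv (power_series c) z = (\<Sum>n. diffs (\<lambda>n. complex_of_real (c n)) n * z ^ n)"
    by (rule DERIV_imp_deriv)
  show "(power_series c has_field_derivative deriv (power_series c) z) (at z)"
    using d eq by simp
  show "(\<lambda>n. of_nat n * of_real (c n) * z ^ (n - 1)) sums deriv (power_series c) z"
    using diffs_equiv[OF termdiff_converges[OF assms(2) sm]] eq by simp
qed

lemma power_series_deriv_of_real_sums:
  assumes "converges_in_disk c" and "0 \<le> r" "r < 1"
  shows "(\<lambda>n. real n * c n * r ^ (n - 1)) sums Re (deriv (power_series c) (of_real r))"
proof -
  have "Re (of_nat n * of_real (c n) * of_real r ^ (n - 1)) = real n * c n * r ^ (n - 1)" for n
    using Re_complex_of_real[of "real n * c n * r ^ (n - 1)"] by simp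
  then show ?thesis
    using sums_Re[OF power_series_deriv_sums[OF assms(1), of "of_real r"]] assms(2,3) by simp
qed

lemma power_series_deriv_of_real:
  assumes "converges_in_disk c" and "0 \<le> r" "r < 1"
  shows "deriv (power_series c) (of_real r) = of_real (Re (deriv (power_series c) (of_real r)))"
proof -
  have "(\<lambda>n. of_nat n * of_real (c n) * of_real r ^ (n - 1)) sums
          complex_of_real (Re (deriv (power_series c) (of_real r)))"
    using sums_of_real[OF power_series_deriv_of_real_sums[OF assms], where 'a = complex] by simp
  then show ?thesis
    using power_series_deriv_sums[OF assms(1), of "of_real r"] assms(2,3)
    by (simp add: sums_unique2)
qed

text \<open>With nonnegative coefficients, the series at the real point \<open>r\<close> majorizes
  the series at \<open>z\<close> term by term.\<close>

lemma norm_power_series_deriv_le: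
  assumes "converges_in_disk c" and "\<And>n. c n \<ge> 0" and "cmod z \<le> r" "r < 1"
  shows "cmod (deriv (power_series c) z) \<le> Re (deriv (power_series c) (of_real r))"
proof (rule norm_sums_le)
  show "(\<lambda>n. of_nat n * of_real (c n) * z ^ (n - 1)) sums deriv (power_series c) z"
    using assms by (intro power_series_deriv_sums) auto
  show "(\<lambda>n. real n * c n * r ^ (n - 1)) sums Re (deriv (power_series c) (of_real r))"
    using assms norm_ge_zero[of z] by (intro power_series_deriv_of_real_sums) linarith+
  show "cmod (of_nat n * of_real (c n) * z ^ (n - 1)) \<le> real n * c n * r ^ (n - 1)" for n
    using assms(2)[of n] assms(3) by (auto simp: norm_mult norm_power intro!: mult_left_mono power_mono)
qed

text \<open>The operator z d/dz multiplies the coefficient of index \<open>n\<close> by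
  \<open>n\<close>, so the combination has coefficients
  \<open>(s + of_nat n * e) * of_real (c n)\<close>. As \<open>c 0 = 0\<close>, a factor
  \<open>cmod z\<close> splits off every term.\<close>

lemma norm_power_series_combination_le:
  assumes "converges_in_disk c" and "\<And>n. c n \<ge> 0" and "c 0 = 0" and "cmod z < 1"
    and "summable (\<lambda>n. cmod (s + of_nat n * e) * c n)"
  shows "cmod (s * power_series c z + e * (z * deriv (power_series c) z))
           \<le> cmod z * (\<Sum>n. cmod (s + of_nat n * e) * c n)"
proof (rule norm_sums_le)
  have "(\<lambda>n. of_real (c n) * z ^ n) sums power_series c z"
    using assms(1,4) by (auto simp: converges_in_disk_def power_series_def summable_sums)
  then have "(\<lambda>n. s * (of_real (c n) * z ^ n) + e * (z * (of_nat n * of_real (c n) * z ^ (n - 1))))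
        sums (s * power_series c z + e * (z * deriv (power_series c) z))"
    using power_series_deriv_sums[OF assms(1,4)] by (intro sums_add sums_mult)
  moreover have "s * (of_real (c n) * z ^ n) + e * (z * (of_nat n * of_real (c n) * z ^ (n - 1)))
      = (s + of_nat n * e) * of_real (c n) * z ^ n" for n
    by (cases n) (auto simp: algebra_simps)
  ultimately show "(\<lambda>n. (s + of_nat n * e) * of_real (c n) * z ^ n)
        sums (s * power_series c z + e * (z * deriv (power_series c) z))"
    by simp
  show "(\<lambda>n. cmod z * (cmod (s + of_nat n * e) * c n)) sums
          (cmod z * (\<Sum>n. cmod (s + of_nat n * e) * c n))"
    using assms(5) by (intro sums_mult summable_sums)
  show "cmod ((s + of_nat n * e) * of_real (c n) * z ^ n) \<le> cmod z * (cmod (s + of_nat n * e) * c n)" for n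
  proof (cases n)
    case (Suc m)
    have "cmod z ^ n \<le> cmod z"
      using assms(4) by (simp add: Suc mult_left_le power_le_one)
    then have "cmod (s + of_nat n * e) * c n * cmod z ^ n \<le> cmod (s + of_nat n * e) * c n * cmod z"
      using assms(2) by (intro mult_left_mono) auto
    then show ?thesis
      using assms(2)[of n] by (simp add: norm_mult norm_power mult.commute)
  qed (use assms(3) in auto)
qed

lemma signed_coeff_decomp_power_series:
  assumes "signed_coeff_decomp f h g a b"
    and "\<And>n. \<alpha> n = (if n < 2 then 0 else cmod (a n))"
    and "\<And>n. \<beta> n = (if n < 1 then 0 else cmod (b n))"
  shows "converges_in_disk \<alpha>" and "converges_in_disk \<beta>"
    and "\<And>z. z \<in> ball 0 1 \<Longrightarrow> h z = z - power_series \<alpha> z"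
    and "\<And>z. z \<in> ball 0 1 \<Longrightarrow> g z = power_series \<beta> z"
proof -
  \<comment> \<open>An equivalence of \<open>sums\<close> for every \<open>s\<close> transfers both
    \<open>summable\<close> and \<open>suminf\<close> by unfolding their definitions.\<close>
  have \<alpha>: "(\<lambda>n. of_real (cmod (a (n + 2))) * z ^ (n + 2)) sums s \<longleftrightarrow>
        (\<lambda>n. of_real (\<alpha> n) * z ^ n) sums s" for z s :: complex
    using sums_zero_iff_shift[of 2 "\<lambda>n. of_real (\<alpha> n) * z ^ n" s] by (simp add: assms(2))
  have \<beta>: "(\<lambda>n. of_real (cmod (b (n + 1))) * z ^ (n + 1)) sums s \<longleftrightarrow>
        (\<lambda>n. of_real (\<beta> n) * z ^ n) sums s" for z s :: complex
    using sums_zero_iff_shift[of 1 "\<lambda>n. of_real (\<beta> n) * z ^ n" s] by (simp add: assms(3))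
  show "converges_in_disk \<alpha>" "converges_in_disk \<beta>"
    using assms(1) unfolding converges_in_disk_def signed_coeff_decomp_def summable_def \<alpha> \<beta>
    by auto
  show "h z = z - power_series \<alpha> z" "g z = power_series \<beta> z" if "z \<in> ball 0 1" for z
    using assms(1) that unfolding signed_coeff_decomp_def power_series_def suminf_def \<alpha> \<beta> by auto
qed

section \<open>Consequences of the Jacobian condition\<close>

text \<open>
  On the real axis \<open>h'\<close> and \<open>g'\<close> are real, and the Jacobian condition keeps \<open>h'\<close> away from 0,
  so that \<open>h' > 0\<close> by continuity.
\<close>

lemma power_series_deriv_sum_less_1:
  assumes \<alpha>: "converges_in_disk \<alpha>" "\<alpha> 1 = 0" and \<beta>: "converges_in_disk \<beta>"
    and jac: "\<And>z. cmod z < 1 \<Longrightarrow>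
           cmod (deriv (power_series \<beta>) z) < cmod (1 - deriv (power_series \<alpha>) z)"
    and r: "0 \<le> r" "r < 1"
  shows "Re (deriv (power_series \<alpha>) (of_real r)) + Re (deriv (power_series \<beta>) (of_real r)) < 1"
proof -
  let ?A = "\<lambda>x. Re (deriv (power_series \<alpha>) (of_real x))"
  let ?B = "\<lambda>x. Re (deriv (power_series \<beta>) (of_real x))"
  \<comment> \<open>Both derivatives are real at real points, so \<open>jac\<close> becomes an
    inequality between absolute values of reals.\<close>
  have lt: "\<bar>?B x\<bar> < \<bar>1 - ?A x\<bar>" if "0 \<le> x" "x \<le> r" for x
  proof -
    have x: "0 \<le> x" "x < 1" using that r by auto
    have "cmod (of_real (?B x)) < cmod (1 - of_real (?A x))"
      using jac[of "of_real x"] x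
      by (simp flip: power_series_deriv_of_real[OF \<alpha>(1) x] power_series_deriv_of_real[OF \<beta> x])
    also have "1 - complex_of_real (?A x) = of_real (1 - ?A x)" by simp
    finally show ?thesis by (simp only: norm_of_real)
  qed
  have "power_series \<alpha> holomorphic_on ball 0 1"
    using power_series_has_field_derivative[OF \<alpha>(1)]
    by (auto simp: holomorphic_on_open) blast
  then have "continuous_on (ball 0 1) (deriv (power_series \<alpha>))"
    by (intro holomorphic_on_imp_continuous_on holomorphic_deriv) auto
  then have "continuous_on {0..r} (\<lambda>x. deriv (power_series \<alpha>) (of_real x))"
    by (rule continuous_on_compose2) (use r in \<open>auto intro!: continuous_intros\<close>)
  then have cont: "continuous_on {0..r} ?A"
    by (intro continuous_intros)
  \<comment> \<open>At 0 only the term of index 1 could survive, and its coefficient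
    vanishes.\<close>
  have "real n * \<alpha> n * 0 ^ (n - 1) = 0" for n
    using \<alpha>(2) by (cases "n = 1") (auto simp: power_0_left)
  then have "(\<lambda>n. real n * \<alpha> n * 0 ^ (n - 1)) = (\<lambda>_. 0)"
    by (rule ext)
  then have "(\<lambda>_. 0) sums ?A 0"
    using power_series_deriv_of_real_sums[OF \<alpha>(1), of 0] by simp
  then have A0: "?A 0 = 0"
    by (rule sums_unique2) (rule sums_zero)
  have "?A r < 1"
  proof (rule ccontr)
    assume "\<not> ?A r < 1"
    \<comment> \<open>\<open>?A\<close> starts at 0, so it would have to take the value 1, where
      \<open>lt\<close> demands a negative bound on an absolute value.\<close>
    then obtain x where "0 \<le> x" "x \<le> r" "?A x = 1"
      using IVT'[of ?A 0 1 r] cont r A0 by auto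
    then show False
      using lt[of x] by simp
  qed
  then show ?thesis
    using lt[of r] r by auto
qed

text \<open>On \<open>cball 0 r\<close> the map \<open>f\<close> minus the identity has Lipschitz
  constant at most the sum of the two derivatives at \<open>r\<close>, which \<open>lt\<close> puts
  below 1.\<close>

lemma inj_on_harmonic_power_series:
  assumes \<alpha>: "converges_in_disk \<alpha>" "\<And>n. \<alpha> n \<ge> 0" and \<beta>: "converges_in_disk \<beta>" "\<And>n. \<beta> n \<ge> 0"
    and lt: "\<And>r. 0 \<le> r \<Longrightarrow> r < 1 \<Longrightarrow>
      Re (deriv (power_series \<alpha>) (of_real r)) + Re (deriv (power_series \<beta>) (of_real r)) < 1"
    and f: "\<And>z. z \<in> ball 0 1 \<Longrightarrow> f z = z - power_series \<alpha> z + cnj (power_series \<beta> z)"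
  shows "inj_on f (ball 0 1)"
proof (rule inj_onI, rule ccontr)
  fix x y assume xy: "x \<in> ball 0 1" "y \<in> ball 0 1" "f x = f y" "x \<noteq> y"
  \<comment> \<open>The larger modulus gives a closed disk inside the unit disk that contains both
    points and is convex, as the mean value bound requires.\<close>
  define r where "r = max (cmod x) (cmod y)"
  have r: "0 \<le> r" "r < 1" and S: "x \<in> cball 0 r" "y \<in> cball 0 r"
    using xy by (auto simp: r_def le_max_iff_disj)
  have lip: "cmod (power_series c x - power_series c y)
        \<le> Re (deriv (power_series c) (of_real r)) * cmod (x - y)"
    if "converges_in_disk c" "\<And>n. c n \<ge> 0" for c
  proof (rule field_differentiable_bound[OF convex_cball _ _ S])
    fix z :: complex assume "z \<in> cball 0 r"
    then have z: "cmod z \<le> r" by simp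
    show "(power_series c has_field_derivative deriv (power_series c) z) (at z within cball 0 r)"
      using z r that(1)
      by (intro has_field_derivative_at_within[OF power_series_has_field_derivative]) auto
    show "cmod (deriv (power_series c) z) \<le> Re (deriv (power_series c) (of_real r))"
      using that z r by (intro norm_power_series_deriv_le) auto
  qed
  have "x - power_series \<alpha> x + cnj (power_series \<beta> x) = y - power_series \<alpha> y + cnj (power_series \<beta> y)"
    using f[OF xy(1)] f[OF xy(2)] xy(3) by metis
  then have "x - y = (power_series \<alpha> x - power_series \<alpha> y) - cnj (power_series \<beta> x - power_series \<beta> y)"
    by (simp add: algebra_simps)
  then have "cmod (x - y) \<le> cmod (power_series \<alpha> x - power_series \<alpha> y)
                 + cmod (power_series \<beta> x - power_series \<beta> y)"
    by (metis norm_triangle_ineq4 complex_mod_cnj)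
  also have "\<dots> \<le> (Re (deriv (power_series \<alpha>) (of_real r)) + Re (deriv (power_series \<beta>) (of_real r))) * cmod (x - y)"
    using lip[OF \<alpha>] lip[OF \<beta>] by (simp add: algebra_simps)
  also have "\<dots> < 1 * cmod (x - y)"
    using lt[OF r] xy(4) by (intro mult_strict_right_mono) auto
  finally show False by simp
qed

text \<open>For \<open>r < 1\<close> nonnegativity bounds the partial sum by the full series, hence
  by 1. A finite sum allows \<open>r\<close> to tend to 1 term by term.\<close>

lemma sum_index_coeff_le_1:
  assumes \<alpha>: "converges_in_disk \<alpha>" "\<And>n. \<alpha> n \<ge> 0" and \<beta>: "converges_in_disk \<beta>" "\<And>n. \<beta> n \<ge> 0"
    and lt: "\<And>r. 0 \<le> r \<Longrightarrow> r < 1 \<Longrightarrow>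
      Re (deriv (power_series \<alpha>) (of_real r)) + Re (deriv (power_series \<beta>) (of_real r)) < 1"
  shows "(\<Sum>n<N. real n * (\<alpha> n + \<beta> n)) \<le> 1"
proof (rule tendsto_upperbound)
  show "((\<lambda>r. \<Sum>n<N. real n * (\<alpha> n + \<beta> n) * r ^ (n - 1)) \<longlongrightarrow> (\<Sum>n<N. real n * (\<alpha> n + \<beta> n))) (at_left (1::real))"
    by (auto intro!: tendsto_eq_intros)
  have "(\<Sum>n<N. real n * (\<alpha> n + \<beta> n) * r ^ (n - 1)) \<le> 1" if r: "0 < r" "r < 1" for r
  proof -
    have "(\<lambda>n. real n * \<alpha> n * r ^ (n - 1) + real n * \<beta> n * r ^ (n - 1)) sums
        (Re (deriv (power_series \<alpha>) (of_real r)) + Re (deriv (power_series \<beta>) (of_real r)))"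
      using r by (intro sums_add power_series_deriv_of_real_sums \<alpha> \<beta>) auto
    then have s: "(\<lambda>n. real n * (\<alpha> n + \<beta> n) * r ^ (n - 1)) sums
        (Re (deriv (power_series \<alpha>) (of_real r)) + Re (deriv (power_series \<beta>) (of_real r)))"
      by (simp add: algebra_simps)
    have "(\<Sum>n<N. real n * (\<alpha> n + \<beta> n) * r ^ (n - 1)) \<le> (\<Sum>n. real n * (\<alpha> n + \<beta> n) * r ^ (n - 1))"
      using \<alpha>(2) \<beta>(2) r by (intro sum_le_suminf sums_summable[OF s]) auto
    then show ?thesis
      using sums_unique[OF s] lt[of r] r by simp
  qed
  then show "\<forall>\<^sub>F r in at_left 1. (\<Sum>n<N. real n * (\<alpha> n + \<beta> n) * r ^ (n - 1)) \<le> 1"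
    by (intro eventually_at_leftI[of 0]) auto
qed auto

section \<open>Bounds for the constants A and B\<close>

lemma spiral_A_ge: "spiral_A lam n \<ge> 2 * real n"
proof -
  have "cmod ((1 + of_nat n * cis (- lam)) - (1 - of_nat n * cis (- lam))) \<le> spiral_A lam n"
    unfolding spiral_A_def by (rule norm_triangle_ineq4)
  also have "(1 + of_nat n * cis (- lam)) - (1 - of_nat n * cis (- lam)) = of_nat (2 * n) * cis (- lam)"
    by simp
  finally show ?thesis by (simp only: norm_mult norm_of_nat norm_cis)
qed

lemma spiral_B_le: "spiral_B lam \<le> 2"
proof -
  have "spiral_B lam \<le> cmod ((1 + cis (- lam)) - (1 - cis (- lam)))"
    unfolding spiral_B_def by (rule norm_triangle_ineq2)
  also have "(1 + cis (- lam)) - (1 - cis (- lam)) = 2 * cis (- lam)"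
    by simp
  finally show ?thesis by (simp only: norm_mult norm_numeral norm_cis)
qed

text \<open>The two moduli have squares differing by \<open>4 * cos lam\<close>, which is positive
  in the given range of \<open>lam\<close>.\<close>

lemma spiral_B_pos:
  assumes "- (pi / 2) < lam" and "lam < pi / 2"
  shows "spiral_B lam > 0"
proof -
  have "(cmod (1 + cis (- lam)))\<^sup>2 - (cmod (1 - cis (- lam)))\<^sup>2 = 4 * cos lam"
    unfolding cmod_power2 by (simp add: power2_eq_square algebra_simps)
  then have "(cmod (1 - cis (- lam)))\<^sup>2 < (cmod (1 + cis (- lam)))\<^sup>2"
    using cos_gt_zero_pi[of lam] assms by simp
  then show ?thesis
    unfolding spiral_B_def by (simp add: power_less_imp_less_base)
qed

text \<open>The quotient is even at most 1. The bound by \<open>n\<close> is the form that compares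
  the necessary condition with the sum of \<open>n * (\<alpha> n + \<beta> n)\<close>.\<close>

lemma spiral_B_div_A_le:
  assumes "n \<ge> 1"
  shows "spiral_B lam / spiral_A lam n \<le> real n"
proof -
  have "real n \<ge> 1" using assms by simp
  then have "2 \<le> spiral_A lam n"
    using spiral_A_ge[of n lam] by linarith
  then have "spiral_B lam / spiral_A lam n \<le> 1"
    using spiral_B_le[of lam] by (simp add: divide_le_eq)
  then show ?thesis using \<open>real n \<ge> 1\<close> by linarith
qed

section \<open>From the coefficient inequality to the spiral condition\<close>

text \<open>Polarization: the squares of the two moduli differ by
  \<open>4 * Re (cnj x * y)\<close>.\<close>

lemma Re_cnj_mult_nonneg:
  assumes "cmod (x - y) \<le> cmod (x + y)"
  shows "Re (cnj x * y) \<ge> 0"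
proof -
  have "(cmod (x - y))\<^sup>2 \<le> (cmod (x + y))\<^sup>2"
    using assms by (intro power_mono) auto
  then show ?thesis
    unfolding cmod_power2 by (simp add: power2_eq_square algebra_simps)
qed

text \<open>For the identity alone, \<open>e * D + F\<close> and \<open>e * D - F\<close> have
  moduli differing by \<open>cmod z * spiral_B lam\<close>. The coefficient of index
  \<open>n\<close> disturbs the two by moduli of \<open>1 + n * e\<close> and
  \<open>1 - n * e\<close>, in one order or the other, hence costs at most
  \<open>cmod z * spiral_A lam n\<close> times itself. The hypothesis \<open>le\<close> keeps the
  total loss within the initial gap.\<close>

lemma spiral_condition:
  assumes \<alpha>: "converges_in_disk \<alpha>" "\<And>n. \<alpha> n \<ge> 0" "\<alpha> 0 = 0"
    and \<beta>: "converges_in_disk \<beta>" "\<And>n. \<beta> n \<ge> 0" "\<beta> 0 = 0"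
    and sm: "summable (\<lambda>n. spiral_A lam n * \<alpha> n)" "summable (\<lambda>n. spiral_A lam n * \<beta> n)"
    and le: "(\<Sum>n. spiral_A lam n * \<alpha> n) + (\<Sum>n. spiral_A lam n * \<beta> n) \<le> spiral_B lam"
    and z: "cmod z < 1"
  shows "Re (cnj (z * (1 - deriv (power_series \<alpha>) z) - cnj (z * deriv (power_series \<beta>) z))
      * (cis lam * (z - power_series \<alpha> z + cnj (power_series \<beta> z)))) \<ge> 0"
proof -
  define e where "e = cis (- lam)"
  define F where "F = z - power_series \<alpha> z + cnj (power_series \<beta> z)"
  define D where "D = z * (1 - deriv (power_series \<alpha>) z) - cnj (z * deriv (power_series \<beta>) z)"
  define U where "U s = s * power_series \<alpha> z + e * (z * deriv (power_series \<alpha>) z)" for s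
  \<comment> \<open>The series of \<open>\<beta>\<close> enters \<open>F\<close> and
    \<open>D\<close> conjugated; the factor \<open>- cnj e\<close> makes \<open>cnj (V s)\<close>
    carry \<open>- e\<close>, for the real values 1 and -1 of \<open>s\<close>.\<close>
  define V where "V s = s * power_series \<beta> z + (- cnj e) * (z * deriv (power_series \<beta>) z)" for s
  define M where "M s c = (\<Sum>n. cmod (s + of_nat n * e) * c n)" for s and c :: "nat \<Rightarrow> real"
  \<comment> \<open>Because of the sign in \<open>V\<close>, the roles of 1 and -1 are swapped for
    \<open>\<beta>\<close>: \<open>V 1\<close> is bounded through \<open>M (- 1)\<close> and
    \<open>V (- 1)\<close> through \<open>M 1\<close>.\<close>
  have nrm: "cmod (1 + of_nat n * (- cnj e)) = cmod (- 1 + of_nat n * e)"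
            "cmod (- 1 + of_nat n * (- cnj e)) = cmod (1 + of_nat n * e)" for n
    using complex_mod_cnj[of "1 - of_nat n * e"] complex_mod_cnj[of "1 + of_nat n * e"]
      norm_minus_commute[of 1 "of_nat n * e"] norm_minus_cancel[of "1 + of_nat n * cnj e"]
    by (simp_all add: algebra_simps)
  have A: "spiral_A lam n = cmod (1 + of_nat n * e) + cmod (- 1 + of_nat n * e)" for n
    using norm_minus_commute[of 1 "of_nat n * e"] by (simp add: spiral_A_def e_def)
  have M: "summable (\<lambda>n. cmod (1 + of_nat n * e) * c n)" (is ?s1)
          "summable (\<lambda>n. cmod (- 1 + of_nat n * e) * c n)" (is ?s2)
          "M 1 c + M (- 1) c = (\<Sum>n. spiral_A lam n * c n)"
    if c: "\<And>n. c n \<ge> 0" "summable (\<lambda>n. spiral_A lam n * c n)" for c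
  proof -
    show 1: ?s1 and 2: ?s2
      using c by (auto intro!: summable_comparison_test'[OF c(2), of 0] mult_right_mono simp: A)
    show "M 1 c + M (- 1) c = (\<Sum>n. spiral_A lam n * c n)"
      unfolding M_def A suminf_add[OF 1 2] by (simp add: algebra_simps)
  qed
  have U: "cmod (U 1) \<le> cmod z * M 1 \<alpha>" "cmod (U (- 1)) \<le> cmod z * M (- 1) \<alpha>"
    unfolding U_def M_def
    by (intro norm_power_series_combination_le \<alpha> z M sm)+
  have V: "cmod (V 1) \<le> cmod z * M (- 1) \<beta>" "cmod (V (- 1)) \<le> cmod z * M 1 \<beta>"
    unfolding V_def M_def nrm[symmetric]
    by (intro norm_power_series_combination_le \<beta> z; simp only: nrm M \<beta> sm)+
  have plus: "(1 + e) * z = (e * D + F) + U 1 - cnj (V 1)"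
    and minus: "e * D - F = - ((1 - e) * z) - U (- 1) + cnj (V (- 1))"
    by (simp_all add: U_def V_def D_def F_def algebra_simps)
  have "cmod (e * D - F) \<le> cmod ((1 - e) * z) + cmod (U (- 1)) + cmod (V (- 1))"
    unfolding minus
    using norm_triangle_ineq[of "- ((1 - e) * z) - U (- 1)" "cnj (V (- 1))"]
      norm_triangle_ineq4[of "- ((1 - e) * z)" "U (- 1)"]
    unfolding norm_minus_cancel complex_mod_cnj by linarith
  moreover have "cmod ((1 + e) * z) \<le> cmod (e * D + F) + cmod (U 1) + cmod (V 1)"
    unfolding plus
    using norm_triangle_ineq4[of "(e * D + F) + U 1" "cnj (V 1)"]
      norm_triangle_ineq[of "e * D + F" "U 1"]
    unfolding complex_mod_cnj by linarith
  moreover have "cmod z * (M 1 \<alpha> + M (- 1) \<alpha> + (M 1 \<beta> + M (- 1) \<beta>)) \<le> cmod z * spiral_B lam"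
    using le M(3)[OF \<alpha>(2) sm(1)] M(3)[OF \<beta>(2) sm(2)] by (intro mult_left_mono) auto
  moreover have "cmod z * spiral_B lam = cmod ((1 + e) * z) - cmod ((1 - e) * z)"
    unfolding spiral_B_def e_def norm_mult right_diff_distrib by (simp only: mult.commute)
  ultimately have "cmod (e * D - F) \<le> cmod (e * D + F)"
    using U V unfolding distrib_left by linarith
  then have "Re (cnj (e * D) * F) \<ge> 0"
    by (rule Re_cnj_mult_nonneg)
  also have "cnj (e * D) * F = cnj D * (cis lam * F)"
    by (simp add: e_def cis_cnj)
  finally show ?thesis by (simp only: D_def F_def)
qed

section \<open>Both directions for a function of the class\<close>

context
  fixes f h g :: "complex \<Rightarrow> complex" and a b :: "nat \<Rightarrow> complex" and \<alpha> \<beta> :: "nat \<Rightarrow> real"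
  assumes f: "f \<in> H_prime" and dec: "signed_coeff_decomp f h g a b"
  defines "\<alpha> n \<equiv> if n < 2 then 0 else cmod (a n)"
    and "\<beta> n \<equiv> if n < 1 then 0 else cmod (b n)"
begin

lemma H_prime_coeffs: "\<alpha> n \<ge> 0" "\<alpha> 0 = 0" "\<alpha> 1 = 0" "\<beta> n \<ge> 0" "\<beta> 0 = 0"
  by (auto simp: \<alpha>_def \<beta>_def)

lemmas H_prime_series = signed_coeff_decomp_power_series[OF dec, of \<alpha> \<beta>,
    OF \<alpha>_def[THEN meta_eq_to_obj_eq] \<beta>_def[THEN meta_eq_to_obj_eq]]

lemma H_prime_decomp: "harmonic_decomp f h g"
  using dec by (simp add: signed_coeff_decomp_def)

lemma H_prime_jacobian_pos:
  assumes "z \<in> ball 0 1"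
  shows "jacobian h g z > 0"
proof -
  obtain h' g' where "harmonic_decomp f h' g'" "\<forall>z\<in>ball 0 1. jacobian h' g' z > 0"
    using f unfolding H_prime_def signed_coeff_decomp_def by blast
  then show ?thesis
    using jacobian_decomp_unique[OF H_prime_decomp] assms by metis
qed

lemma H_prime_derivs:
  assumes "z \<in> ball 0 1"
  shows "deriv h z = 1 - deriv (power_series \<alpha>) z" "deriv g z = deriv (power_series \<beta>) z"
proof -
  have "((\<lambda>z. z - power_series \<alpha> z) has_field_derivative 1 - deriv (power_series \<alpha>) z) (at z)"
    using assms H_prime_series(1) by (intro derivative_intros power_series_has_field_derivative) auto
  then have "(h has_field_derivative 1 - deriv (power_series \<alpha>) z) (at z)"
    by (rule has_field_derivative_transform_within_open[where S = "ball 0 1"])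
       (use assms H_prime_series(3) in auto)
  then show "deriv h z = 1 - deriv (power_series \<alpha>) z" by (rule DERIV_imp_deriv)
  have "(power_series \<beta> has_field_derivative deriv (power_series \<beta>) z) (at z)"
    using assms H_prime_series(2) by (intro power_series_has_field_derivative) auto
  then have "(g has_field_derivative deriv (power_series \<beta>) z) (at z)"
    by (rule has_field_derivative_transform_within_open[where S = "ball 0 1"])
       (use assms H_prime_series(4) in auto)
  then show "deriv g z = deriv (power_series \<beta>) z" by (rule DERIV_imp_deriv)
qed

lemma H_prime_deriv_sum_less_1:
  assumes "0 \<le> r" "r < 1"
  shows "Re (deriv (power_series \<alpha>) (of_real r)) + Re (deriv (power_series \<beta>) (of_real r)) < 1"
proof (rule power_series_deriv_sum_less_1[OF H_prime_series(1) H_prime_coeffs(3) H_prime_series(2) _ assms])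
  fix z :: complex assume "cmod z < 1"
  then have z: "z \<in> ball 0 1" by simp
  have "(cmod (deriv (power_series \<beta>) z))\<^sup>2 < (cmod (1 - deriv (power_series \<alpha>) z))\<^sup>2"
    using H_prime_jacobian_pos[OF z] by (simp add: jacobian_def H_prime_derivs[OF z])
  then show "cmod (deriv (power_series \<beta>) z) < cmod (1 - deriv (power_series \<alpha>) z)"
    by (simp add: power_less_imp_less_base)
qed

lemma H_prime_f_eq: "z \<in> ball 0 1 \<Longrightarrow> f z = z - power_series \<alpha> z + cnj (power_series \<beta> z)"
  using H_prime_decomp H_prime_series(3,4) by (simp add: harmonic_decomp_def)

text \<open>The weight \<open>C\<close> is left free so as to cover both quotients, A over B and B
  over A.\<close>

lemma H_prime_shift_sums:
  "(\<lambda>n. C (n + 2) * cmod (a (n + 2))) sums s \<longleftrightarrow> (\<lambda>n. C n * \<alpha> n) sums s"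
  "(\<lambda>n. C (n + 1) * cmod (b (n + 1))) sums s \<longleftrightarrow> (\<lambda>n. C n * \<beta> n) sums s" for C :: "nat \<Rightarrow> real"
  using sums_zero_iff_shift[of 2 "\<lambda>n. C n * \<alpha> n" s] sums_zero_iff_shift[of 1 "\<lambda>n. C n * \<beta> n" s]
  by (simp_all add: \<alpha>_def \<beta>_def)

lemma H_prime_shift_series:
  "summable (\<lambda>n. C (n + 2) * cmod (a (n + 2))) \<longleftrightarrow> summable (\<lambda>n. C n * \<alpha> n)"
  "summable (\<lambda>n. C (n + 1) * cmod (b (n + 1))) \<longleftrightarrow> summable (\<lambda>n. C n * \<beta> n)"
  "(\<Sum>n. C (n + 2) * cmod (a (n + 2))) = (\<Sum>n. C n * \<alpha> n)"
  "(\<Sum>n. C (n + 1) * cmod (b (n + 1))) = (\<Sum>n. C n * \<beta> n)" for C :: "nat \<Rightarrow> real"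
  unfolding summable_def suminf_def H_prime_shift_sums[of C] by (rule refl)+

text \<open>Multiplying the inequality by \<open>spiral_B lam\<close> gives the hypothesis of
  \<open>spiral_condition\<close>, while injectivity comes from the Jacobian condition.\<close>

lemma spirallike_sufficient:
  assumes lam: "- (pi / 2) < lam" "lam < pi / 2"
    and sm: "summable (\<lambda>n. spiral_A lam (n + 2) / spiral_B lam * cmod (a (n + 2)))"
      "summable (\<lambda>n. spiral_A lam (n + 1) / spiral_B lam * cmod (b (n + 1)))"
    and le: "(\<Sum>n. spiral_A lam (n + 2) / spiral_B lam * cmod (a (n + 2)))
      + (\<Sum>n. spiral_A lam (n + 1) / spiral_B lam * cmod (b (n + 1))) \<le> 1"
  shows "f \<in> SP_H_prime lam"
proof -
  have B: "spiral_B lam > 0" using lam by (rule spiral_B_pos)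
  have *: "summable (\<lambda>n. spiral_A lam n / spiral_B lam * \<alpha> n)"
          "summable (\<lambda>n. spiral_A lam n / spiral_B lam * \<beta> n)"
          "(\<Sum>n. spiral_A lam n / spiral_B lam * \<alpha> n) + (\<Sum>n. spiral_A lam n / spiral_B lam * \<beta> n) \<le> 1"
    using sm le H_prime_shift_series[of "\<lambda>n. spiral_A lam n / spiral_B lam"] by simp_all
  have scale: "spiral_B lam * (spiral_A lam n / spiral_B lam * c) = spiral_A lam n * c" for n c
    using B by simp
  have sm': "summable (\<lambda>n. spiral_A lam n * \<alpha> n)" "summable (\<lambda>n. spiral_A lam n * \<beta> n)"
    using *(1,2)[THEN summable_mult, of "spiral_B lam"] by (simp_all only: scale)
  have "(\<Sum>n. spiral_A lam n * \<alpha> n) + (\<Sum>n. spiral_A lam n * \<beta> n)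
      = spiral_B lam * ((\<Sum>n. spiral_A lam n / spiral_B lam * \<alpha> n) + (\<Sum>n. spiral_A lam n / spiral_B lam * \<beta> n))"
    unfolding distrib_left suminf_mult[OF *(1), symmetric] suminf_mult[OF *(2), symmetric] scale ..
  also have "\<dots> \<le> spiral_B lam"
    using mult_left_mono[OF *(3), of "spiral_B lam"] B by simp
  finally have le': "(\<Sum>n. spiral_A lam n * \<alpha> n) + (\<Sum>n. spiral_A lam n * \<beta> n) \<le> spiral_B lam" .
  have "hereditarily_spirallike lam f"
  proof (rule hereditarily_spirallikeI[OF H_prime_decomp H_prime_jacobian_pos])
    show "inj_on f (ball 0 1)"
      by (rule inj_on_harmonic_power_series[OF H_prime_series(1) H_prime_coeffs(1) H_prime_series(2)
            H_prime_coeffs(4) H_prime_deriv_sum_less_1 H_prime_f_eq])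
    show "f 0 = 0"
      using H_prime_f_eq[of 0] H_prime_coeffs by (simp add: power_series_def)
    fix z :: complex assume z: "z \<in> ball 0 1"
    then show "Re (cnj (z * deriv h z - cnj (z * deriv g z)) * (cis lam * f z)) \<ge> 0"
      unfolding H_prime_f_eq[OF z] H_prime_derivs[OF z] using H_prime_coeffs H_prime_series(1,2) sm' le'
      by (intro spiral_condition) auto
  qed
  then show ?thesis using f by (simp add: SP_H_prime_def)
qed

text \<open>Each weight of index \<open>n \<ge> 1\<close> is at most \<open>n\<close>, so the
  partial sums are dominated by those of \<open>n * (\<alpha> n + \<beta> n)\<close>, which are at
  most 1.\<close>

lemma H_prime_coeff_bound:
  assumes lam: "- (pi / 2) < lam" "lam < pi / 2"
  shows "summable (\<lambda>n. spiral_B lam / spiral_A lam (n + 2) * cmod (a (n + 2)))"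
    and "summable (\<lambda>n. spiral_B lam / spiral_A lam (n + 1) * cmod (b (n + 1)))"
    and "(\<Sum>n. spiral_B lam / spiral_A lam (n + 2) * cmod (a (n + 2)))
      + (\<Sum>n. spiral_B lam / spiral_A lam (n + 1) * cmod (b (n + 1))) \<le> 1"
proof -
  let ?C = "\<lambda>n. spiral_B lam / spiral_A lam n"
  have C0: "?C n \<ge> 0" for n
    using spiral_B_pos[OF lam] by (simp add: spiral_A_def)
  \<comment> \<open>At \<open>n = 0\<close> the weight is half of \<open>spiral_B lam\<close> and
    thus exceeds \<open>n\<close>; there the coefficient must vanish.\<close>
  have C_le: "?C n * c \<le> real n * c" if "c \<ge> 0" "n = 0 \<Longrightarrow> c = 0" for n c
    using that mult_right_mono[OF spiral_B_div_A_le[of n lam], of c] by (cases "n = 0") auto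
  have le: "(\<Sum>n<N. ?C n * \<alpha> n + ?C n * \<beta> n) \<le> 1" for N
  proof -
    have "(\<Sum>n<N. ?C n * \<alpha> n + ?C n * \<beta> n) \<le> (\<Sum>n<N. real n * (\<alpha> n + \<beta> n))"
      unfolding distrib_left using H_prime_coeffs by (intro sum_mono add_mono C_le) auto
    also have "\<dots> \<le> 1"
      by (rule sum_index_coeff_le_1[OF H_prime_series(1) H_prime_coeffs(1) H_prime_series(2)
            H_prime_coeffs(4) H_prime_deriv_sum_less_1])
    finally show ?thesis .
  qed
  have nn: "0 \<le> ?C n * \<alpha> n" "0 \<le> ?C n * \<beta> n" for n
    by (intro mult_nonneg_nonneg C0 H_prime_coeffs)+
  \<comment> \<open>The bound 1 holds for the two series jointly, so the combined series is summed
    first and each part follows by comparison.\<close>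
  have sm: "summable (\<lambda>n. ?C n * \<alpha> n + ?C n * \<beta> n)"
    using nn le by (intro summableI_nonneg_bounded[of _ 1] add_nonneg_nonneg)
  have sm\<alpha>: "summable (\<lambda>n. ?C n * \<alpha> n)" and sm\<beta>: "summable (\<lambda>n. ?C n * \<beta> n)"
    using nn
    by (intro summable_comparison_test'[OF sm, of 0];
        simp only: real_norm_def abs_of_nonneg le_add_same_cancel1 le_add_same_cancel2)+
  then show "summable (\<lambda>n. ?C (n + 2) * cmod (a (n + 2)))" "summable (\<lambda>n. ?C (n + 1) * cmod (b (n + 1)))"
    using H_prime_shift_series(1,2)[of ?C] by simp_all
  have "(\<Sum>n. ?C n * \<alpha> n) + (\<Sum>n. ?C n * \<beta> n) \<le> 1"
    unfolding suminf_add[OF sm\<alpha> sm\<beta>] using sm le by (rule suminf_le_const)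
  then show "(\<Sum>n. ?C (n + 2) * cmod (a (n + 2))) + (\<Sum>n. ?C (n + 1) * cmod (b (n + 1))) \<le> 1"
    using H_prime_shift_series(3,4)[of ?C] by simp
qed

end

theorem theorem2p3:
  fixes lam :: real
  assumes "- (pi / 2) < lam" and "lam < pi / 2"
  shows "(\<forall>f h g a b.
            f \<in> H_prime \<longrightarrow> signed_coeff_decomp f h g a b \<longrightarrow>
            summable (\<lambda>n. spiral_A lam (n + 2) / spiral_B lam * cmod (a (n + 2))) \<longrightarrow>
            summable (\<lambda>n. spiral_A lam (n + 1) / spiral_B lam * cmod (b (n + 1))) \<longrightarrow>
            (\<Sum>n. spiral_A lam (n + 2) / spiral_B lam * cmod (a (n + 2)))
              + (\<Sum>n. spiral_A lam (n + 1) / spiral_B lam * cmod (b (n + 1))) \<le> 1 \<longrightarrow>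
            f \<in> SP_H_prime lam)
       \<and> (\<forall>f h g a b.
            f \<in> SP_H_prime lam \<longrightarrow> signed_coeff_decomp f h g a b \<longrightarrow>
            summable (\<lambda>n. spiral_B lam / spiral_A lam (n + 2) * cmod (a (n + 2))) \<and>
            summable (\<lambda>n. spiral_B lam / spiral_A lam (n + 1) * cmod (b (n + 1))) \<and>
            (\<Sum>n. spiral_B lam / spiral_A lam (n + 2) * cmod (a (n + 2)))
              + (\<Sum>n. spiral_B lam / spiral_A lam (n + 1) * cmod (b (n + 1))) \<le> 1)"
proof (intro conjI allI impI)
  fix f h g a b
  assume "f \<in> SP_H_prime lam" and dec: "signed_coeff_decomp f h g a b"
  then have f: "f \<in> H_prime" by (simp add: SP_H_prime_def)
  note bound = H_prime_coeff_bound[OF f dec assms]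
  show "summable (\<lambda>n. spiral_B lam / spiral_A lam (n + 2) * cmod (a (n + 2)))"
    "summable (\<lambda>n. spiral_B lam / spiral_A lam (n + 1) * cmod (b (n + 1)))"
    "(\<Sum>n. spiral_B lam / spiral_A lam (n + 2) * cmod (a (n + 2)))
      + (\<Sum>n. spiral_B lam / spiral_A lam (n + 1) * cmod (b (n + 1))) \<le> 1"
    by (fact bound)+
qed (rule spirallike_sufficient[OF _ _ assms])

end
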